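(* Let $D_1$ and $D_2$ be two digraphs on $n_1$ and $n_2$ vertices, and $m_1$ and $m_2$ arcs, respectively. Then $$f_{A(D_1\mathbin{\dot\vee} D_2)}(\lambda)=\lambda^{m_1-n_1}\, f_{A(D_1)}(\lambda^2)\, f_{A(D_2)}(\lambda)\,\left[1-\lambda\,\chi_{A(D_1)}(\lambda^2)\,\chi_{A(D_2)}(\lambda)\right].$$ In particular, the $A$-spectrum of $D_1\mathbin{\dot\vee} D_2$ is completely determined by the $A$-spectra of $D_1$ and $D_2$, and the $A$-coronals of $D_1$ and $D_2$.
   Context: Digraphs are finite, have at least one vertex, and are simple (no loops, no multiple arcs), but both arcs $uv$ and $vu$ may be present. The adjacency matrix $A(D)=[a_{ij}]$ of a digraph $D$ with vertices $v_1,\dots,v_n$ has $a_{ij}=1$ if $v_iv_j$ is an arc and $a_{ij}=0$ otherwise. For an $n\times n$ real matrix $M$, $f_M(\lambda)=\det(\lambda I_n-M)$ is its characteristic polynomial and its coronal is $\chi_M(\lambda)=\mathbf 1_n^T(\lambda I_n-M)^{-1}\mathbf 1_n\in\mathbb C(\lambda)$, where $\mathbf 1_n$ is the all-ones column vector. The $A$-spectrum of $D$ is the multiset of roots of $f_{A(D)}$, and the $A$-coronal of $D$ is $\chi_{A(D)}$. Identities are in $\mathbb C(\lambda)$. "Completely determined by" certain data means that equal data yield equal spectra. The subdivision digraph $\mathcal S(D)$ is obtained from $D$ by replacing each arc $uv$ by a directed path $u\to w\to v$ of length two through a new vertex $w$ (one new vertex per arc). The subdivision-vertex join $D_1\mathbin{\dot\vee}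 D_2$ is obtained from the disjoint union of $\mathcal S(D_1)$ and $D_2$ by adding both arcs $vw$ and $wv$ for every original vertex $v\in V(D_1)$ and every $w\in V(D_2)$. *)

theory Defs
  imports
    "HOL-Computational_Algebra.Computational_Algebra"
    "HOL-Computational_Algebra.Field_as_Ring"
    "Jordan_Normal_Form.Char_Poly"
    "Jordan_Normal_Form.Gauss_Jordan_Elimination"
    "Graph_Theory.Pair_Digraph"
begin

section \<open>Digraphs\<close>

text \<open>
  A \<^locale>\<open>pair_digraph\<close> is a finite loop-free digraph whose arcs form a set of ordered pairs, so
  multiple arcs are excluded and opposite arcs are allowed. It may be empty, hence the extra
  condition.
\<close>

definition simple_digraph :: "'a pair_pre_digraph \<Rightarrow> bool" where
  "simple_digraph D \<longleftrightarrow> pair_digraph D \<and> pverts D \<noteq> {}"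

definition vertex_ordering :: "'a pair_pre_digraph \<Rightarrow> 'a list \<Rightarrow> bool" where
  "vertex_ordering D vs \<longleftrightarrow> distinct vs \<and> set vs = pverts D"

text \<open>In the subdivision, \<open>Inr e\<close> is the new vertex inserted into the arc \<open>e\<close>.\<close>

definition subdivision_digraph :: "'a pair_pre_digraph \<Rightarrow> ('a + 'a \<times> 'a) pair_pre_digraph" where
  "subdivision_digraph D =
     \<lparr> pverts = Inl ` pverts D \<union> Inr ` parcs D,
       parcs = {(Inl u, Inr (u, v)) | u v. (u, v) \<in> parcs D} \<union>
               {(Inr (u, v), Inl v) | u v. (u, v) \<in> parcs D} \<rparr>"

definition subdivision_vertex_join ::
  "'a pair_pre_digraph \<Rightarrow> 'b pair_pre_digraph \<Rightarrow> (('a + 'a \<times> 'a) + 'b) pair_pre_digraph" where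
  "subdivision_vertex_join D1 D2 =
     \<lparr> pverts = Inl ` pverts (subdivision_digraph D1) \<union> Inr ` pverts D2,
       parcs = {(Inl x, Inl y) | x y. (x, y) \<in> parcs (subdivision_digraph D1)} \<union>
               {(Inr x, Inr y) | x y. (x, y) \<in> parcs D2} \<union>
               {(Inl (Inl v), Inr w) | v w. v \<in> pverts D1 \<and> w \<in> pverts D2} \<union>
               {(Inr w, Inl (Inl v)) | v w. v \<in> pverts D1 \<and> w \<in> pverts D2} \<rparr>"

lemma simple_digraph_subdivision_vertex_join:
  assumes "simple_digraph D1" "simple_digraph D2"
  shows "simple_digraph (subdivision_vertex_join D1 D2)"
proof -
  interpret D1: pair_digraph D1 using assms by (simp add: simple_digraph_def)
  interpret D2: pair_digraph D2 using assms by (simp add: simple_digraph_def)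
  let ?J = "subdivision_vertex_join D1 D2"
  note defs = subdivision_vertex_join_def subdivision_digraph_def
  have fin: "finite (pverts ?J)"
    using D1.pair_finite_verts D1.pair_finite_arcs D2.pair_finite_verts by (simp add: defs)
  have sub: "parcs ?J \<subseteq> pverts ?J \<times> pverts ?J"
    by (auto simp: defs D1.in_arcsD1 D1.in_arcsD2 D2.in_arcsD1 D2.in_arcsD2)
  have "finite (parcs ?J)"
    using fin sub finite_subset by blast
  moreover have "fst e \<noteq> snd e" if "e \<in> parcs ?J" for e
    using that D2.pair_no_loops by (fastforce simp: defs)
  ultimately have "pair_digraph ?J"
    using fin sub by unfold_locales auto
  thus ?thesis
    using assms by (auto simp: simple_digraph_def defs)
qed

section \<open>Characteristic polynomial, spectrum and coronal\<close>

text \<open>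
  The adjacency matrix with respect to the ordering \<open>vs\<close> of the vertices; its real entries are
  regarded as complex numbers.
\<close>

definition adjacency_matrix :: "'a pair_pre_digraph \<Rightarrow> 'a list \<Rightarrow> complex mat" where
  "adjacency_matrix D vs =
     mat (length vs) (length vs) (\<lambda>(i, j). if (vs ! i, vs ! j) \<in> parcs D then 1 else 0)"

definition A_spectrum :: "'a pair_pre_digraph \<Rightarrow> 'a list \<Rightarrow> complex multiset" where
  "A_spectrum D vs = proots (char_poly (adjacency_matrix D vs))"

text \<open>The field of rational functions in \<open>\<lambda>\<close> is the fraction field of the polynomial ring.\<close>

type_synonym ratfun = "complex poly fract"

definition rat_var :: ratfun where
  "rat_var = to_fract [:0, 1:]"

text \<open>
  \<^term>\<open>char_poly_matrix M\<close> is the polynomial matrix \<open>\<lambda>I - M\<close>; it is inverted over the field of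
  rational functions.
\<close>

definition coronal :: "complex mat \<Rightarrow> ratfun" where
  "coronal M =
     (let one_vec = vec (dim_row M) (\<lambda>_. 1)
      in one_vec \<bullet> (the (mat_inverse (map_mat to_fract (char_poly_matrix M))) *\<^sub>v one_vec))"

lemma mat_inverse_char_poly_matrix:
  fixes M :: "complex mat"
  assumes "M \<in> carrier_mat n n"
  shows "\<exists>B. mat_inverse (map_mat to_fract (char_poly_matrix M)) = Some B \<and>
             map_mat to_fract (char_poly_matrix M) * B = 1\<^sub>m n \<and>
             B * map_mat to_fract (char_poly_matrix M) = 1\<^sub>m n \<and> B \<in> carrier_mat n n"
proof -
  interpret h: comm_ring_hom "to_fract :: complex poly \<Rightarrow> ratfun"
    by unfold_locales auto
  let ?X = "map_mat to_fract (char_poly_matrix M) :: ratfun mat"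
  have X: "?X \<in> carrier_mat n n"
    using assms by simp
  have "char_poly M \<noteq> 0"
    using degree_monic_char_poly[OF assms] by auto
  hence "det ?X \<noteq> 0"
    by (simp add: h.hom_det char_poly_def)
  hence "?X \<in> Units (ring_mat TYPE(ratfun) n ())"
    by (rule det_non_zero_imp_unit[OF X])
  then obtain B where "mat_inverse ?X = Some B"
    using mat_inverse(1)[OF X, of "()"] by (cases "mat_inverse ?X") simp_all
  thus ?thesis
    using mat_inverse(2)[OF X] by blast
qed

text \<open>
  The substitution of \<open>\<lambda>\<^sup>2\<close> for \<open>\<lambda>\<close> in a rational function. Numerator and denominator are those in
  lowest terms, but any other representation gives the same result.
\<close>

definition at_square :: "ratfun \<Rightarrow> ratfun" where
  "at_square r =
     (case quot_of_fract r of (p, q) \<Rightarrow>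
        to_fract (pcompose p (monom 1 2)) / to_fract (pcompose q (monom 1 2)))"

lemma at_square_divide:
  assumes "q \<noteq> 0"
  shows "at_square (to_fract p / to_fract q) =
           to_fract (pcompose p (monom 1 2)) / to_fract (pcompose q (monom 1 2))"
proof -
  have nz: "pcompose b (monom 1 2) \<noteq> 0" if "b \<noteq> 0" for b :: "complex poly"
    using that pcompose_eq_0[of b "monom 1 2"] by (auto simp: degree_monom_eq)
  obtain a b where ab: "quot_of_fract (to_fract p / to_fract q) = (a, b)"
    by fastforce
  have b: "b \<noteq> 0"
    using snd_quot_of_fract_nonzero[of "to_fract p / to_fract q"] ab by simp
  have "to_fract p / to_fract q = to_fract a / to_fract b"
    using quot_to_fract_quot_of_fract[of "to_fract p / to_fract q"] ab
    by (simp add: quot_to_fract_def Fract_conv_to_fract)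
  hence "to_fract (p * b) = to_fract (a * q)"
    using assms b by (simp add: field_simps)
  hence "p * b = a * q"
    by (simp only: to_fract_eq_iff)
  hence "pcompose p (monom 1 2) * pcompose b (monom 1 2) =
         pcompose a (monom 1 2) * pcompose q (monom 1 2)"
    by (simp flip: pcompose_mult)
  hence "to_fract (pcompose p (monom 1 2)) * to_fract (pcompose b (monom 1 2)) =
         to_fract (pcompose a (monom 1 2)) * to_fract (pcompose q (monom 1 2))"
    by (simp flip: to_fract_mult)
  thus ?thesis
    using nz[OF assms] nz[OF b] by (simp add: at_square_def ab field_simps)
qed

end

theory Submission
  imports Defs
begin

text \<open>
  Write \<open>J\<close> for all-ones matrices and \<open>R\<close>, \<open>T\<close> for the tail and head incidence matrices of
  \<open>D\<^sub>1\<close> (original vertices by arcs, and arcs by original vertices), so that \<open>R T = A(D\<^sub>1)\<close>. With the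
  vertices of the join listed as arcs of \<open>D\<^sub>1\<close>, vertices of \<open>D\<^sub>2\<close>, vertices of \<open>D\<^sub>1\<close>, the matrix
  \<open>\<lambda>I - A\<close> of the join consists of a block-diagonal part with blocks \<open>\<lambda>I\<close> and \<open>\<lambda>I - A(D\<^sub>2)\<close>,
  bordered by the columns \<open>-T, -J\<close> and the rows \<open>-R, -J\<close> and the corner \<open>\<lambda>I\<close>. Eliminating the
  block-diagonal part contributes \<open>\<lambda>\<^bsup>m\<^esup> f\<^sub>2(\<lambda>)\<close> and leaves the Schur complement
  \<open>\<lambda>I - A(D\<^sub>1)/\<lambda> - \<chi>\<^sub>2(\<lambda>) J = \<lambda>\<^sup>-\<^sup>1 (\<lambda>\<^sup>2 I - A(D\<^sub>1) - \<lambda> \<chi>\<^sub>2(\<lambda>) J)\<close>: the walks of length two through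
  the subdividing vertices restore \<open>A(D\<^sub>1)\<close>, and a detour through \<open>D\<^sub>2\<close> joins every pair of
  original vertices with the same weight, the coronal of \<open>D\<^sub>2\<close>. Subtracting \<open>c J\<close> from a matrix
  \<open>X\<close> multiplies the determinant by \<open>1 - c 1\<^sup>T X\<^sup>-\<^sup>1 1\<close>, and for \<open>X = \<lambda>\<^sup>2 I - A(D\<^sub>1)\<close> this brings in
  \<open>\<chi>\<^sub>1(\<lambda>\<^sup>2)\<close>. The elimination is lemma \<open>det_vertex_matrix_eliminate\<close>, the rank-one correction is
  \<open>det_vertex_matrix_minus_const\<close>, and they meet in \<open>det_char_entry_join\<close>.

  In place of inverse matrices, the adjugate supplies polynomials \<open>p y\<close> with
  \<open>(\<lambda>I - A) p = f 1\<close>; then \<open>p / f\<close> solves the system with right-hand side \<open>1\<close>, its entries sum to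
  the coronal, and substituting \<open>\<lambda>\<^sup>2\<close> for \<open>\<lambda>\<close> keeps the polynomial identity true.

  The formula also contains the numbers of vertices and arcs of \<open>D\<^sub>1\<close>. The first is the degree of
  the characteristic polynomial. The second is seen in the expansion
  \<open>\<chi>(\<lambda>) = n/\<lambda> + m/\<lambda>\<^sup>2 + \<dots>\<close> at infinity, whose coefficients count walks
  (\<open>coronal_numerator_expansion\<close>). Hence spectra and coronals determine the right-hand side, and a
  monic complex polynomial is the same thing as the multiset of its roots.
\<close>

section \<open>Determinants of matrices indexed by vertices\<close>

text \<open>
  Keeping the index lists explicit lets matrix products be written as sums over sets of vertices,
  so that block decompositions become concatenations of lists.
\<close>

definition vertex_matrix :: "('a \<Rightarrow> 'b \<Rightarrow> 'c) \<Rightarrow> 'a list \<Rightarrow> 'b list \<Rightarrow> 'c mat" where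
  "vertex_matrix g xs ys = mat (length xs) (length ys) (\<lambda>(i, j). g (xs ! i) (ys ! j))"

lemma vertex_matrix_carrier [simp]:
  "vertex_matrix g xs ys \<in> carrier_mat (length xs) (length ys)"
  by (simp add: vertex_matrix_def)

lemma dim_vertex_matrix [simp]:
  "dim_row (vertex_matrix g xs ys) = length xs" "dim_col (vertex_matrix g xs ys) = length ys"
  by (simp_all add: vertex_matrix_def)

lemma vertex_matrix_cong:
  assumes "\<And>x y. x \<in> set xs \<Longrightarrow> y \<in> set ys \<Longrightarrow> g x y = h x y"
  shows "vertex_matrix g xs ys = vertex_matrix h xs ys"
  unfolding vertex_matrix_def using assms by (intro cong_mat) auto

lemma vertex_matrix_map:
  "vertex_matrix g (map f xs) (map f' ys) = vertex_matrix (\<lambda>x y. g (f x) (f' y)) xs ys"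
  unfolding vertex_matrix_def by (intro eq_matI) auto

lemma vertex_matrix_append:
  "vertex_matrix g (xs @ ys) (us @ ws) =
     four_block_mat (vertex_matrix g xs us) (vertex_matrix g xs ws)
       (vertex_matrix g ys us) (vertex_matrix g ys ws)"
  unfolding vertex_matrix_def by (intro eq_matI) (auto simp: nth_append)

lemma sum_nth_distinct:
  assumes "distinct xs"
  shows "(\<Sum>i = 0..<length xs. f (xs ! i)) = (\<Sum>x\<in>set xs. f x)"
  using assms
  by (intro sum.reindex_bij_betw bij_betw_nth) (auto simp: atLeast0LessThan)

lemma vertex_matrix_mult:
  fixes g :: "'a \<Rightarrow> 'b \<Rightarrow> 'c :: comm_ring_1"
  assumes "distinct ys"
  shows "vertex_matrix g xs ys * vertex_matrix h ys zs =
           vertex_matrix (\<lambda>x z. \<Sum>y\<in>set ys. g x y * h y z) xs zs"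
  unfolding vertex_matrix_def
  by (intro eq_matI) (auto simp: scalar_prod_def simp flip: sum_nth_distinct[OF assms])

lemma vertex_matrix_one:
  assumes "distinct xs"
  shows "vertex_matrix (\<lambda>x y. if x = y then 1 else 0) xs xs = 1\<^sub>m (length xs)"
  unfolding vertex_matrix_def using assms by (intro eq_matI) (auto simp: nth_eq_iff_index_eq)

text \<open>
  The two matrices are conjugate by the permutation matrix between the two lists, which in this
  notation is the identity kernel with rows indexed by one list and columns by the other.
\<close>

lemma det_vertex_matrix_reorder:
  fixes g :: "'a \<Rightarrow> 'a \<Rightarrow> 'c :: comm_ring_1"
  assumes "distinct xs" "distinct ys" "set xs = set ys"
  shows "det (vertex_matrix g xs xs) = det (vertex_matrix g ys ys)"
proof -
  define \<delta> :: "'a \<Rightarrow> 'a \<Rightarrow> 'c" where "\<delta> = (\<lambda>x y. if x = y then 1 else 0)"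
  have delta: "(if P then 1 else 0) * a = (if P then a else 0)"
    "a * (if P then 1 else 0) = (if P then a else 0)" for P and a :: 'c
    by simp_all
  let ?P = "vertex_matrix \<delta> xs ys" and ?Q = "vertex_matrix \<delta> ys xs"
  let ?n = "length xs"
  have len: "length ys = ?n"
    using assms by (metis distinct_card)
  have c: "vertex_matrix h us ws \<in> carrier_mat ?n ?n"
    if "length us = ?n" "length ws = ?n" for h :: "'a \<Rightarrow> 'a \<Rightarrow> 'c" and us ws
    using that by (metis vertex_matrix_carrier)
  note cs = c[OF refl len] c[OF len refl] c[OF len len] c[OF refl refl]
  have "?P * ?Q = 1\<^sub>m ?n"
    using assms unfolding vertex_matrix_mult[OF assms(2)]
    by (subst vertex_matrix_one[symmetric], simp)
      (auto intro!: vertex_matrix_cong simp: \<delta>_def delta)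
  hence PQ: "det ?P * det ?Q = 1"
    using det_mult[OF cs(1)[of \<delta>] cs(2)[of \<delta>]] det_one[of ?n, where 'a = 'c] by metis
  have "vertex_matrix g xs xs = ?P * vertex_matrix g ys ys * ?Q"
    unfolding vertex_matrix_mult[OF assms(2)]
    using assms
    by (intro vertex_matrix_cong)
      (auto simp: \<delta>_def delta)
  hence "det (vertex_matrix g xs xs) = det ?P * det (vertex_matrix g ys ys) * det ?Q"
    using det_mult[OF mult_carrier_mat[OF cs(1)[of \<delta>] cs(3)[of g]] cs(2)[of \<delta>]]
      det_mult[OF cs(1)[of \<delta>] cs(3)[of g]] by simp
  thus ?thesis
    using PQ by (metis mult.commute mult.left_commute mult_1)
qed

text \<open>
  Schur complement without inverses: if \<open>A K = B\<close>, then right multiplication by the unipotent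
  matrix with upper right block \<open>K\<close> turns the block matrix with rows \<open>A, 0\<close> and \<open>C, D - C K\<close> into
  the one with rows \<open>A, B\<close> and \<open>C, D\<close>.
\<close>

lemma det_vertex_matrix_eliminate:
  fixes g :: "'a \<Rightarrow> 'a \<Rightarrow> 'c :: idom"
  assumes "distinct xs"
    and solves: "\<And>x z. x \<in> set xs \<Longrightarrow> z \<in> set ys \<Longrightarrow> (\<Sum>y\<in>set xs. g x y * k y z) = g x z"
  shows "det (vertex_matrix g (xs @ ys) (xs @ ys)) =
           det (vertex_matrix g xs xs) *
           det (vertex_matrix (\<lambda>x z. g x z - (\<Sum>y\<in>set xs. g x y * k y z)) ys ys)"
proof -
  let ?m = "length xs" and ?n = "length ys"
  let ?A = "vertex_matrix g xs xs" and ?B = "vertex_matrix g xs ys"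
    and ?C = "vertex_matrix g ys xs" and ?D = "vertex_matrix g ys ys"
    and ?K = "vertex_matrix k xs ys"
    and ?S = "vertex_matrix (\<lambda>x z. g x z - (\<Sum>y\<in>set xs. g x y * k y z)) ys ys"
  have AK: "?A * ?K = ?B"
    unfolding vertex_matrix_mult[OF assms(1)] by (intro vertex_matrix_cong solves)
  have CK: "?C * ?K + ?S = ?D"
    unfolding vertex_matrix_mult[OF assms(1)]
    unfolding vertex_matrix_def by (intro eq_matI) auto
  have "four_block_mat ?A (0\<^sub>m ?m ?n) ?C ?S * four_block_mat (1\<^sub>m ?m) ?K (0\<^sub>m ?n ?m) (1\<^sub>m ?n)
      = four_block_mat ?A ?B ?C ?D"
    by (subst mult_four_block_mat[where ?nr1.0 = ?m and ?n1.0 = ?m and ?n2.0 = ?n and ?nr2.0 = ?n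
          and ?nc1.0 = ?m and ?nc2.0 = ?n]) (auto simp: AK CK right_add_zero_mat[OF vertex_matrix_carrier])
  moreover have "det (four_block_mat ?A (0\<^sub>m ?m ?n) ?C ?S) = det ?A * det ?S"
    by (intro det_four_block_mat_upper_right_zero) auto
  moreover have "det (four_block_mat (1\<^sub>m ?m) ?K (0\<^sub>m ?n ?m) (1\<^sub>m ?n)) = (1 :: 'c)"
    by (subst det_four_block_mat_lower_left_zero[where n = ?m and m = ?n]) auto
  moreover have "det (four_block_mat ?A (0\<^sub>m ?m ?n) ?C ?S *
      four_block_mat (1\<^sub>m ?m) ?K (0\<^sub>m ?n ?m) (1\<^sub>m ?n)) =
      det (four_block_mat ?A (0\<^sub>m ?m ?n) ?C ?S) *
      det (four_block_mat (1\<^sub>m ?m) ?K (0\<^sub>m ?n ?m) (1\<^sub>m ?n))"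
    by (intro det_mult[where n = "?m + ?n"]) auto
  ultimately show ?thesis
    by (simp add: vertex_matrix_append)
qed

lemma det_vertex_matrix_diagonal:
  fixes t :: "'c :: comm_ring_1"
  assumes "distinct xs"
  shows "det (vertex_matrix (\<lambda>x y. if x = y then t else 0) xs xs) = t ^ length xs"
proof -
  have "vertex_matrix (\<lambda>x y. if x = y then t else 0) xs xs = t \<cdot>\<^sub>m 1\<^sub>m (length xs)"
    unfolding vertex_matrix_def using assms by (intro eq_matI) (auto simp: nth_eq_iff_index_eq)
  thus ?thesis by simp
qed

lemma det_vertex_matrix_scale:
  fixes c :: "'c :: comm_ring_1"
  shows "det (vertex_matrix (\<lambda>x y. c * g x y) xs xs) = c ^ length xs * det (vertex_matrix g xs xs)"
proof -
  have "vertex_matrix (\<lambda>x y. c * g x y) xs xs = c \<cdot>\<^sub>m vertex_matrix g xs xs"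
    unfolding vertex_matrix_def by (intro eq_matI) auto
  thus ?thesis by (simp add: vertex_matrix_def)
qed

text \<open>
  Border \<open>g\<close> with one extra index \<open>None\<close>, with corner \<open>1\<close>, a row of ones and a column of \<open>c\<close>.
  Eliminating \<open>None\<close> leaves \<open>g - c J\<close>, while eliminating the old indices, with \<open>c w\<close> as solution of
  the linear system, leaves the single entry \<open>1 - c \<Sum>w\<close>.
\<close>

lemma det_vertex_matrix_minus_const:
  fixes g :: "'a \<Rightarrow> 'a \<Rightarrow> 'c :: idom"
  assumes "distinct xs"
    and w: "\<And>x. x \<in> set xs \<Longrightarrow> (\<Sum>y\<in>set xs. g x y * w y) = 1"
  shows "det (vertex_matrix (\<lambda>x y. g x y - c) xs xs) =
           det (vertex_matrix g xs xs) * (1 - c * (\<Sum>x\<in>set xs. w x))"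
proof -
  define b :: "'a option \<Rightarrow> 'a option \<Rightarrow> 'c" where
    "b p q = (case p of None \<Rightarrow> 1 | Some x \<Rightarrow> (case q of None \<Rightarrow> c | Some y \<Rightarrow> g x y))" for p q
  let ?S = "map Some xs"
  have single: "det (vertex_matrix h [None] [None]) = h None None"
    for h :: "'a option \<Rightarrow> 'a option \<Rightarrow> 'c"
    by (simp add: vertex_matrix_def det_single)
  have some: "(\<Sum>p\<in>set ?S. f p) = (\<Sum>x\<in>set xs. f (Some x))" for f :: "'a option \<Rightarrow> 'c"
    by (simp add: sum.reindex)
  have "det (vertex_matrix b ([None] @ ?S) ([None] @ ?S)) =
      det (vertex_matrix (\<lambda>x y. g x y - c) xs xs)"
    by (subst det_vertex_matrix_eliminate[where k = "\<lambda>_ _. 1"])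
      (auto simp: b_def single vertex_matrix_map)
  moreover have "det (vertex_matrix b (?S @ [None]) (?S @ [None])) =
      det (vertex_matrix g xs xs) * (1 - c * (\<Sum>x\<in>set xs. w x))"
  proof (subst det_vertex_matrix_eliminate[where k = "\<lambda>p _. case p of None \<Rightarrow> 0 | Some x \<Rightarrow> c * w x"])
    show "distinct ?S" using assms(1) by (simp add: distinct_map)
    show "(\<Sum>q\<in>set ?S. b p q * (case q of None \<Rightarrow> 0 | Some x \<Rightarrow> c * w x)) = b p z"
      if pz: "p \<in> set ?S" "z \<in> set [None]" for p z
    proof -
      obtain x where x: "p = Some x" "x \<in> set xs" using pz by auto
      have "(\<Sum>y\<in>set xs. g x y * (c * w y)) = c * (\<Sum>y\<in>set xs. g x y * w y)"
        by (simp add: sum_distrib_left mult_ac)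
      thus ?thesis unfolding some using pz x w by (simp add: b_def)
    qed
  qed (simp_all only: single some, simp add: b_def vertex_matrix_map sum_distrib_left)
  moreover have "det (vertex_matrix b ([None] @ ?S) ([None] @ ?S)) =
      det (vertex_matrix b (?S @ [None]) (?S @ [None]))"
    using assms(1) by (intro det_vertex_matrix_reorder) (auto simp: distinct_map)
  ultimately show ?thesis by simp
qed

section \<open>Characteristic polynomial and coronal of a digraph\<close>

text \<open>
  The entries of \<open>t I - A(D)\<close>. The parameter \<open>t\<close> is taken to be \<open>\<lambda>\<close> as a polynomial, and \<open>\<lambda>\<close> or
  \<open>\<lambda>\<^sup>2\<close> as a rational function.
\<close>

definition char_entry :: "'c :: comm_ring_1 \<Rightarrow> 'a pair_pre_digraph \<Rightarrow> 'a \<Rightarrow> 'a \<Rightarrow> 'c" where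
  "char_entry t D x y = (if x = y then t else 0) - (if (x, y) \<in> parcs D then 1 else 0)"

lemma adjacency_matrix_carrier [simp]:
  "adjacency_matrix D vs \<in> carrier_mat (length vs) (length vs)"
  by (simp add: adjacency_matrix_def)

lemma char_poly_matrix_adjacency:
  assumes "distinct vs"
  shows "char_poly_matrix (adjacency_matrix D vs) = vertex_matrix (char_entry [:0, 1:] D) vs vs"
  unfolding char_poly_matrix_def adjacency_matrix_def vertex_matrix_def char_entry_def
  using assms by (intro eq_matI) (auto simp: nth_eq_iff_index_eq one_pCons)

lemma hom_char_poly_adjacency:
  fixes D :: "'v pair_pre_digraph" and h :: "complex poly \<Rightarrow> 'r :: comm_ring_1"
  assumes "comm_ring_hom h" and "distinct vs"
  shows "h (char_poly (adjacency_matrix D vs)) = det (vertex_matrix (char_entry (h [:0, 1:]) D) vs vs)"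
proof -
  interpret h: comm_ring_hom h by fact
  have "map_mat h (vertex_matrix (char_entry [:0, 1:] D) vs vs) =
      vertex_matrix (char_entry (h [:0, 1:]) D) vs vs"
    unfolding vertex_matrix_def
    by (intro eq_matI) (auto simp: char_entry_def h.hom_minus)
  thus ?thesis
    by (metis char_poly_def char_poly_matrix_adjacency[OF assms(2)] h.hom_det)
qed

text \<open>
  The vector \<open>p\<close> is the adjugate of \<open>\<lambda>I - A\<close> applied to the all-ones vector. Its entries are
  polynomials, so the equations that it satisfies survive every substitution for \<open>\<lambda>\<close>.
\<close>

lemma char_poly_adjacency_solution:
  fixes D :: "'a pair_pre_digraph" and vs :: "'a list"
  defines "f \<equiv> char_poly (adjacency_matrix D vs)"
  assumes "distinct vs"
  obtains p where
    "\<And>x. x \<in> set vs \<Longrightarrow> (\<Sum>y\<in>set vs. char_entry [:0, 1:] D x y * p y) = f"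
    "to_fract f * coronal (adjacency_matrix D vs) = to_fract (\<Sum>y\<in>set vs. p y)"
proof -
  interpret h: comm_ring_hom "to_fract :: complex poly \<Rightarrow> ratfun"
    by unfold_locales auto
  define n where "n = length vs"
  define A where "A = adjacency_matrix D vs"
  define X where "X = char_poly_matrix A"
  define one :: "complex poly vec" where "one = vec n (\<lambda>_. 1)"
  define v where "v = adj_mat X *\<^sub>v one"
  define p where "p y = v $ inv_into {0..<n} ((!) vs) y" for y
  have A: "A \<in> carrier_mat n n" and X: "X \<in> carrier_mat n n"
    by (simp_all add: A_def X_def n_def)
  have one: "one \<in> carrier_vec n" by (simp add: one_def)
  have v: "v \<in> carrier_vec n" using adj_mat(1)[OF X] one by (simp add: v_def)
  have Xv: "X *\<^sub>v v = f \<cdot>\<^sub>v one"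
  proof -
    have "X *\<^sub>v v = (X * adj_mat X) *\<^sub>v one"
      unfolding v_def using X adj_mat(1)[OF X] one by simp
    also have "\<dots> = f \<cdot>\<^sub>v one"
      unfolding adj_mat(2)[OF X] using one
      by (intro eq_vecI) (simp_all add: f_def char_poly_def X_def A_def)
    finally show ?thesis .
  qed
  have p: "p (vs ! i) = v $ i" if "i < n" for i
    using that assms(2) by (simp add: p_def n_def inj_on_nth inv_into_f_f)
  have sums: "(\<Sum>y\<in>set vs. g y) = (\<Sum>i = 0..<n. g (vs ! i))" for g :: "'a \<Rightarrow> complex poly"
    by (simp add: n_def sum_nth_distinct[OF assms(2), of g])
  show ?thesis
  proof (rule that)
    fix x assume "x \<in> set vs"
    then obtain i where i: "i < n" "x = vs ! i" by (auto simp: in_set_conv_nth n_def)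
    have "(X *\<^sub>v v) $ i = (\<Sum>j = 0..<n. X $$ (i, j) * v $ j)"
      using X v i by (simp add: scalar_prod_def)
    also have "\<dots> = (\<Sum>y\<in>set vs. char_entry [:0, 1:] D x y * p y)"
      unfolding sums using i assms(2)
      by (intro sum.cong)
        (auto simp: p X_def A_def char_poly_matrix_adjacency vertex_matrix_def n_def)
    finally show "(\<Sum>y\<in>set vs. char_entry [:0, 1:] D x y * p y) = f"
      using i one unfolding Xv by (simp add: one_def)
  next
    let ?X = "map_mat to_fract X :: ratfun mat" and ?v = "map_vec to_fract v :: ratfun vec"
      and ?one = "vec n (\<lambda>_. 1) :: ratfun vec"
    obtain B where B: "mat_inverse ?X = Some B" "B * ?X = 1\<^sub>m n" "B \<in> carrier_mat n n"
      using mat_inverse_char_poly_matrix[OF A] unfolding X_def by blast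
    have "?X *\<^sub>v ?v = map_vec to_fract (X *\<^sub>v v)"
      using h.mult_mat_vec_hom[OF X v] by simp
    also have "\<dots> = to_fract f \<cdot>\<^sub>v ?one"
      unfolding Xv by (intro eq_vecI) (auto simp: one_def)
    finally have Xv': "?X *\<^sub>v ?v = to_fract f \<cdot>\<^sub>v ?one" .
    have "?v = (B * ?X) *\<^sub>v ?v" using B v by simp
    also have "\<dots> = B *\<^sub>v (?X *\<^sub>v ?v)"
      using B X v by (intro assoc_mult_mat_vec) auto
    also have "\<dots> = to_fract f \<cdot>\<^sub>v (B *\<^sub>v ?one)"
      unfolding Xv' using B by (simp add: mult_mat_vec)
    finally have "?one \<bullet> ?v = to_fract f * (?one \<bullet> (B *\<^sub>v ?one))"
      using B by (metis mult_mat_vec_carrier scalar_prod_smult_distrib vec_carrier)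
    moreover have "?one \<bullet> (B *\<^sub>v ?one) = coronal A"
      using A B by (simp add: coronal_def X_def Let_def)
    moreover have "?one \<bullet> ?v = to_fract (\<Sum>y\<in>set vs. p y)"
      unfolding sums using v by (simp add: scalar_prod_def p h.hom_sum)
    ultimately show "to_fract f * coronal (adjacency_matrix D vs) = to_fract (\<Sum>y\<in>set vs. p y)"
      by (simp add: A_def)
  qed
qed

lemma char_poly_adjacency_nonzero: "char_poly (adjacency_matrix D vs) \<noteq> 0"
  using degree_monic_char_poly[OF adjacency_matrix_carrier] by (metis coeff_0 zero_neq_one)

lemma hom_char_entry:
  assumes "comm_ring_hom h"
  shows "h (char_entry t D x y) = char_entry (h t) D x y"
proof -
  interpret h: comm_ring_hom h by fact
  show ?thesis by (simp add: char_entry_def h.hom_minus)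
qed

text \<open>
  Both the inclusion of polynomials into rational functions and its composition with
  \<open>\<lambda> \<mapsto> \<lambda>\<^sup>2\<close> serve as \<open>h\<close>, and the solution found here is the vector \<open>w\<close> in
  \<open>det_vertex_matrix_minus_const\<close>.
\<close>

lemma hom_coronal_solution:
  fixes D :: "'a pair_pre_digraph" and h :: "complex poly \<Rightarrow> ratfun"
  assumes "comm_ring_hom h"
    and p: "\<And>x. x \<in> set vs \<Longrightarrow> (\<Sum>y\<in>set vs. char_entry [:0, 1:] D x y * p y) = f"
    and "h f \<noteq> 0" and "x \<in> set vs"
  shows "(\<Sum>y\<in>set vs. char_entry (h [:0, 1:]) D x y * (h (p y) / h f)) = 1"
proof -
  interpret h: comm_ring_hom h by fact
  have "h f = (\<Sum>y\<in>set vs. char_entry (h [:0, 1:]) D x y * h (p y))"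
    using assms(4) by (simp flip: p add: h.hom_sum h.hom_mult hom_char_entry[OF assms(1)])
  thus ?thesis
    using assms(3) by (simp flip: sum_divide_distrib)
qed

section \<open>What the spectrum and the coronal determine\<close>

lemma sum_adjacency_eq_card_arcs:
  fixes D :: "'a pair_pre_digraph"
  assumes "finite V" "parcs D \<subseteq> V \<times> V"
  shows "(\<Sum>x\<in>V. \<Sum>y\<in>V. if (x, y) \<in> parcs D then 1 else 0) = (of_nat (card (parcs D)) :: 'c :: comm_ring_1)"
proof -
  have "(\<Sum>x\<in>V. \<Sum>y\<in>V. if (x, y) \<in> parcs D then 1 else 0) =
      (\<Sum>e\<in>V \<times> V. if e \<in> parcs D then 1 else (0 :: 'c))"
    by (simp add: sum.cartesian_product case_prod_unfold)
  also have "\<dots> = (\<Sum>e\<in>parcs D. 1)"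
    using assms by (intro sum.mono_neutral_cong_right) auto
  finally show ?thesis by simp
qed

text \<open>
  With \<open>\<chi> = S / f\<close> for \<open>S = \<Sum>p\<close> and \<open>f\<close> of degree \<open>n\<close>, this is \<open>\<lambda>\<^sup>2 \<chi> = m + n \<lambda> + O(1/\<lambda>)\<close>, written without
  denominators. The system reads \<open>\<lambda> p = f 1 + A p\<close>, and applying it twice gives
  \<open>\<lambda>\<^sup>2 S = n \<lambda> f + (1\<^sup>T A 1) f + 1\<^sup>T A\<^sup>2 p\<close>. The same equation bounds the degrees: the right-hand
  side has degree at most \<open>max n (deg p)\<close>, so an entry of largest degree, which gains one on the
  left, has degree below \<open>n\<close>.
\<close>

lemma coronal_numerator_expansion:
  fixes D :: "'a pair_pre_digraph" and V :: "'a set" and p :: "'a \<Rightarrow> complex poly"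
  assumes V: "finite V" "V \<noteq> {}" "parcs D \<subseteq> V \<times> V"
    and f: "degree f \<le> card V"
    and p: "\<And>x. x \<in> V \<Longrightarrow> (\<Sum>y\<in>V. char_entry [:0, 1:] D x y * p y) = f"
  obtains r where "degree r < card V"
    "[:0, 0, 1:] * (\<Sum>y\<in>V. p y) = [:of_nat (card (parcs D)), of_nat (card V):] * f + r"
proof -
  define a :: "'a \<Rightarrow> 'a \<Rightarrow> complex" where "a x y = (if (x, y) \<in> parcs D then 1 else 0)" for x y
  define L :: "complex poly" where "L = [:0, 1:]"
  have n: "0 < card V" using V by (simp add: card_gt_0_iff)
  have row: "L * p x = f + (\<Sum>y\<in>V. Polynomial.smult (a x y) (p y))" if x: "x \<in> V" for x
  proof -
    have "char_entry L D x y * p y = (if x = y then L * p y else 0) - Polynomial.smult (a x y) (p y)" for y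
      by (simp add: char_entry_def a_def algebra_simps)
    hence "f = L * p x - (\<Sum>y\<in>V. Polynomial.smult (a x y) (p y))"
      using p[OF x] x V(1) by (simp add: L_def sum_subtractf)
    thus ?thesis by simp
  qed
  have deg: "degree (p x) < card V" if "x \<in> V" for x
  proof (rule ccontr)
    define d where "d = Max ((\<lambda>x. degree (p x)) ` V)"
    have le: "degree (p y) \<le> d" if "y \<in> V" for y
      using that V(1) by (simp add: d_def)
    obtain z where z: "z \<in> V" "degree (p z) = d"
      using Max_in[of "(\<lambda>x. degree (p x)) ` V"] V unfolding d_def[symmetric] by blast
    assume "\<not> degree (p x) < card V"
    hence d: "card V \<le> d" using le[OF that] by simp
    hence "p z \<noteq> 0" using z n by auto
    hence "Suc d = degree (L * p z)"
      using z by (simp add: L_def)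
    also have "\<dots> \<le> d"
      unfolding row[OF z(1)] using f d V(1) le
      by (intro degree_add_le degree_sum_le) (auto intro: order.trans[OF degree_smult_le])
    finally show False by simp
  qed
  \<comment> \<open>\<open>c\<close> is the row vector \<open>1\<^sup>T A\<close> of in-degrees, and \<open>r = 1\<^sup>T A\<^sup>2 p\<close>.\<close>
  define c where "c y = (\<Sum>x\<in>V. a x y)" for y
  define r where "r = (\<Sum>y\<in>V. Polynomial.smult (c y) (\<Sum>z\<in>V. Polynomial.smult (a y z) (p z)))"
  have "L * (\<Sum>x\<in>V. p x) = (\<Sum>x\<in>V. f + (\<Sum>y\<in>V. Polynomial.smult (a x y) (p y)))"
    unfolding sum_distrib_left by (intro sum.cong row) auto
  also have "\<dots> = of_nat (card V) * f + (\<Sum>x\<in>V. \<Sum>y\<in>V. Polynomial.smult (a x y) (p y))"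
    by (simp add: sum.distrib)
  also have "(\<Sum>x\<in>V. \<Sum>y\<in>V. Polynomial.smult (a x y) (p y)) = (\<Sum>y\<in>V. Polynomial.smult (c y) (p y))"
    by (subst sum.swap) (simp add: c_def smult_sum)
  finally have "L * (L * (\<Sum>x\<in>V. p x)) = of_nat (card V) * L * f + (\<Sum>y\<in>V. Polynomial.smult (c y) (L * p y))"
    by (simp add: distrib_left sum_distrib_left mult_ac)
  also have "(\<Sum>y\<in>V. Polynomial.smult (c y) (L * p y)) = Polynomial.smult (\<Sum>y\<in>V. c y) f + r"
    by (simp add: row smult_add_right sum.distrib r_def smult_sum cong: sum.cong)
  also have "(\<Sum>y\<in>V. c y) = of_nat (card (parcs D))"
    unfolding c_def a_def by (subst sum.swap) (rule sum_adjacency_eq_card_arcs[OF V(1,3)])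
  finally have "[:0, 0, 1:] * (\<Sum>y\<in>V. p y) = [:of_nat (card (parcs D)), of_nat (card V):] * f + r"
    by (simp add: L_def of_nat_poly)
  moreover have "degree r < card V"
    unfolding r_def using V(1) n deg
    by (intro degree_sum_less) (auto intro!: le_less_trans[OF degree_smult_le] degree_sum_less)
  ultimately show ?thesis using that by blast
qed

text \<open>
  A monic complex polynomial is the product of its linear factors.
\<close>

lemma char_poly_eq_of_spectrum_eq:
  assumes "A_spectrum E us = A_spectrum D vs"
  shows "char_poly (adjacency_matrix E us) = char_poly (adjacency_matrix D vs)"
proof -
  have "(\<Prod>x\<in>#A_spectrum F ws. [:- x, 1:]) = char_poly (adjacency_matrix F ws)" for F :: "'x pair_pre_digraph" and ws
    using complex_poly_decompose_multiset[of "char_poly (adjacency_matrix F ws)"]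
      degree_monic_char_poly[OF adjacency_matrix_carrier[of F ws]]
    by (simp add: A_spectrum_def)
  thus ?thesis using assms by metis
qed

text \<open>
  Equal characteristic polynomials and coronals give equal numerators \<open>S\<close> and equal vertex numbers.
  Subtracting the two expansions of \<open>\<lambda>\<^sup>2 S\<close>, the difference of the arc numbers times \<open>f\<close> is a
  polynomial of degree less than that of \<open>f\<close>, hence zero.
\<close>

lemma card_eq_of_char_poly_coronal_eq:
  assumes "simple_digraph D" "simple_digraph E" "vertex_ordering D vs" "vertex_ordering E us"
    and f: "char_poly (adjacency_matrix E us) = char_poly (adjacency_matrix D vs)"
    and cor: "coronal (adjacency_matrix E us) = coronal (adjacency_matrix D vs)"
  shows "card (pverts E) = card (pverts D)" and "card (parcs E) = card (parcs D)"
proof -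
  let ?f = "char_poly (adjacency_matrix D vs)"
  have deg: "degree (char_poly (adjacency_matrix F ws)) = card (pverts F)"
    if "vertex_ordering F ws" for F :: "'x pair_pre_digraph" and ws
    using that degree_monic_char_poly[OF adjacency_matrix_carrier[of F ws]]
    by (metis distinct_card vertex_ordering_def)
  show n: "card (pverts E) = card (pverts D)"
    using deg[OF assms(3)] deg[OF assms(4)] f by simp
  have num: "\<exists>S r. to_fract (char_poly (adjacency_matrix F ws)) * coronal (adjacency_matrix F ws) = to_fract S \<and>
      degree r < card (pverts F) \<and>
      [:0, 0, 1:] * S = [:of_nat (card (parcs F)), of_nat (card (pverts F)):]
        * char_poly (adjacency_matrix F ws) + r"
    if F: "simple_digraph F" "vertex_ordering F ws" for F :: "'x pair_pre_digraph" and ws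
  proof -
    interpret pair_digraph F using F by (simp add: simple_digraph_def)
    have ws: "set ws = pverts F" "distinct ws" using F by (auto simp: vertex_ordering_def)
    obtain p where p:
      "\<And>x. x \<in> set ws \<Longrightarrow> (\<Sum>y\<in>set ws. char_entry [:0, 1:] F x y * p y) = char_poly (adjacency_matrix F ws)"
      "to_fract (char_poly (adjacency_matrix F ws)) * coronal (adjacency_matrix F ws)
         = to_fract (\<Sum>y\<in>set ws. p y)"
      using char_poly_adjacency_solution[OF ws(2), of F] by blast
    have "parcs F \<subseteq> pverts F \<times> pverts F" "pverts F \<noteq> {}"
      using F in_arcsD1 in_arcsD2 by (auto simp: simple_digraph_def)
    then obtain r where "degree r < card (pverts F)"
      "[:0, 0, 1:] * (\<Sum>y\<in>pverts F. p y) =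
        [:of_nat (card (parcs F)), of_nat (card (pverts F)):] * char_poly (adjacency_matrix F ws) + r"
      using coronal_numerator_expansion[of "pverts F" F "char_poly (adjacency_matrix F ws)" p]
        p(1) deg[OF F(2)] ws by auto
    thus ?thesis using p(2) ws by metis
  qed
  obtain S r where S: "to_fract ?f * coronal (adjacency_matrix D vs) = to_fract S"
    "degree r < card (pverts D)"
    "[:0, 0, 1:] * S = [:of_nat (card (parcs D)), of_nat (card (pverts D)):] * ?f + r"
    using num[OF assms(1,3)] by blast
  obtain S' r' where S': "to_fract ?f * coronal (adjacency_matrix D vs) = to_fract S'"
    "degree r' < card (pverts D)"
    "[:0, 0, 1:] * S' = [:of_nat (card (parcs E)), of_nat (card (pverts D)):] * ?f + r'"
    using num[OF assms(2,4)] unfolding f cor n by blast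
  have "S = S'" using S(1) S'(1) by simp
  hence "Polynomial.smult (of_nat (card (parcs E)) - of_nat (card (parcs D))) ?f = r - r'"
    using S(3) S'(3) by (simp add: algebra_simps smult_diff_left)
  hence "Polynomial.smult (of_nat (card (parcs E)) - of_nat (card (parcs D))) ?f = 0"
    using S(2) S'(2) deg[OF assms(3)] degree_diff_less[of r "card (pverts D)" r']
    by (metis degree_smult_eq less_irrefl smult_0_left)
  thus "card (parcs E) = card (parcs D)"
    using char_poly_adjacency_nonzero[of D vs] by simp
qed

section \<open>The subdivision-vertex join\<close>

text \<open>
  The subdividing vertices and \<open>D2\<close> are not adjacent to each other, so eliminating both at once
  gives the two separate contributions described at the beginning.
\<close>

lemma det_char_entry_join:
  fixes D1 :: "'a pair_pre_digraph" and D2 :: "'b pair_pre_digraph" and t :: "'r :: field"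
    and vs :: "(('a + 'a \<times> 'a) + 'b) list"
  assumes D1: "simple_digraph D1" and D2: "simple_digraph D2"
    and vs1: "vertex_ordering D1 vs1" and vs2: "vertex_ordering D2 vs2"
    and vs: "vertex_ordering (subdivision_vertex_join D1 D2) vs"
    and t: "t \<noteq> 0"
    and w1: "\<And>x. x \<in> pverts D1 \<Longrightarrow> (\<Sum>y\<in>pverts D1. char_entry (t\<^sup>2) D1 x y * w1 y) = 1"
    and w2: "\<And>x. x \<in> pverts D2 \<Longrightarrow> (\<Sum>y\<in>pverts D2. char_entry t D2 x y * w2 y) = 1"
  shows "det (vertex_matrix (char_entry t (subdivision_vertex_join D1 D2)) vs vs) =
           t powi (int (card (parcs D1)) - int (card (pverts D1))) *
           det (vertex_matrix (char_entry (t\<^sup>2) D1) vs1 vs1) *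
           det (vertex_matrix (char_entry t D2) vs2 vs2) *
           (1 - t * (\<Sum>x\<in>pverts D1. w1 x) * (\<Sum>x\<in>pverts D2. w2 x))"
proof -
  interpret D1: pair_digraph D1 using D1 by (simp add: simple_digraph_def)
  interpret D2: pair_digraph D2 using D2 by (simp add: simple_digraph_def)
  define J where "J = subdivision_vertex_join D1 D2"
  define g where "g = char_entry t J"
  let ?n = "card (pverts D1)" and ?m = "card (parcs D1)"
  let ?W1 = "\<Sum>x\<in>pverts D1. w1 x" and ?W2 = "\<Sum>x\<in>pverts D2. w2 x"
  obtain es where es: "set es = parcs D1" "distinct es"
    using finite_distinct_list[OF D1.pair_finite_arcs] by auto
  have vs1': "set vs1 = pverts D1" "distinct vs1" and vs2': "set vs2 = pverts D2" "distinct vs2"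
    using vs1 vs2 by (auto simp: vertex_ordering_def)
  let ?E = "map (\<lambda>e. Inl (Inr e)) es :: (('a + 'a \<times> 'a) + 'b) list"
    and ?V1 = "map (\<lambda>x. Inl (Inl x)) vs1 :: (('a + 'a \<times> 'a) + 'b) list"
    and ?V2 = "map Inr vs2 :: (('a + 'a \<times> 'a) + 'b) list"
  have distE: "distinct ?E" and distV2: "distinct ?V2" and distV1: "distinct ?V1"
    using es vs1' vs2' by (simp_all add: distinct_map inj_on_def)
  have sumE: "(\<Sum>q\<in>set ?E. f q) = (\<Sum>e\<in>parcs D1. f (Inl (Inr e)))"
    and sumV2: "(\<Sum>q\<in>set ?V2. f q) = (\<Sum>b\<in>pverts D2. f (Inr b))"
    for f :: "_ \<Rightarrow> 'r"
    using es vs2' by (simp_all add: sum.reindex inj_on_def)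
  have sumEV2: "(\<Sum>q\<in>set (?E @ ?V2). f q) =
      (\<Sum>e\<in>parcs D1. f (Inl (Inr e))) + (\<Sum>b\<in>pverts D2. f (Inr b))" for f :: "_ \<Rightarrow> 'r"
    unfolding set_append by (subst sum.union_disjoint) (auto simp only: sumE sumV2 finite_set, auto)

  note defs = g_def J_def char_entry_def subdivision_vertex_join_def subdivision_digraph_def
  have gEE: "g (Inl (Inr e)) (Inl (Inr e')) = (if e = e' then t else 0)" for e e'
    by (auto simp: defs)
  have gEV: "g (Inl (Inr e)) (Inl (Inl z)) = (if snd e = z then - 1 else 0)"
    if "e \<in> parcs D1" for e z
    using that by (cases e) (auto simp: defs)
  have gVE: "g (Inl (Inl x)) (Inl (Inr e)) = (if fst e = x then - 1 else 0)"
    if "e \<in> parcs D1" for e x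
    using that by (cases e) (auto simp: defs)
  have gE2: "g (Inl (Inr e)) (Inr b) = 0" "g (Inr b) (Inl (Inr e)) = 0" for e b
    by (auto simp: defs)
  have g22: "g (Inr b) (Inr b') = char_entry t D2 b b'" for b b'
    by (auto simp: defs)
  have gV2: "g (Inl (Inl x)) (Inr b) = - 1" "g (Inr b) (Inl (Inl x)) = - 1"
    if "x \<in> pverts D1" "b \<in> pverts D2" for x b
    using that by (auto simp: defs)
  have gVV: "g (Inl (Inl x)) (Inl (Inl z)) = (if x = z then t else 0)" for x z
    by (auto simp: defs)

  have det1: "det (vertex_matrix g (?E @ ?V2) (?E @ ?V2)) =
      t ^ ?m * det (vertex_matrix (char_entry t D2) vs2 vs2)"
  proof -
    have "vertex_matrix g ?E ?E = vertex_matrix (\<lambda>e e'. if e = e' then t else 0) es es"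
      by (simp add: vertex_matrix_map gEE)
    hence "det (vertex_matrix g ?E ?E) = t ^ ?m"
      using det_vertex_matrix_diagonal[OF es(2), of t] es by (metis distinct_card)
    thus ?thesis
      using distE
      by (subst det_vertex_matrix_eliminate[where k = "\<lambda>_ _. 0"])
        (auto simp: gE2 vertex_matrix_map g22)
  qed

  \<comment> \<open>The solution of the system for the eliminated block: \<open>-T/t\<close> on the arcs, and on \<open>D2\<close> the
    vector \<open>-w2\<close> in every column.\<close>
  define k :: "('a + 'a \<times> 'a) + 'b \<Rightarrow> ('a + 'a \<times> 'a) + 'b \<Rightarrow> 'r" where
    "k p q = (case p of Inr b \<Rightarrow> - w2 b
       | Inl (Inr e) \<Rightarrow> if q = Inl (Inl (snd e)) then - 1 / t else 0
       | Inl (Inl x) \<Rightarrow> 0)" for p q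
  have solves: "(\<Sum>q\<in>set (?E @ ?V2). g p q * k q z) = g p z"
    if p: "p \<in> set (?E @ ?V2)" and z: "z \<in> set ?V1" for p z
  proof -
    obtain y where y: "z = Inl (Inl y)" "y \<in> pverts D1" using z vs1' by auto
    from p consider e where "p = Inl (Inr e)" "e \<in> parcs D1" | b where "p = Inr b" "b \<in> pverts D2"
      using es vs2' by auto
    thus ?thesis
    proof cases
      case 1
      have "(\<Sum>e'\<in>parcs D1. g p (Inl (Inr e')) * k (Inl (Inr e')) z) =
          (\<Sum>e'\<in>parcs D1. if e = e' then t * k (Inl (Inr e)) z else 0)"
        by (intro sum.cong) (auto simp: 1 gEE)
      also have "\<dots> = g p z"
        using 1 y t D1.pair_finite_arcs by (auto simp: gEV k_def)
      finally show ?thesis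
        unfolding sumEV2 by (simp add: 1 gE2)
    next
      case 2
      have "(\<Sum>b'\<in>pverts D2. char_entry t D2 b b' * w2 b') = 1" using w2 2 by simp
      thus ?thesis
        unfolding sumEV2 using 2 y by (simp add: gE2 g22 k_def gV2 sum_negf)
    qed
  qed
  have reduced: "g (Inl (Inl x)) (Inl (Inl z)) - (\<Sum>q\<in>set (?E @ ?V2). g (Inl (Inl x)) q * k q (Inl (Inl z)))
      = 1 / t * (char_entry (t\<^sup>2) D1 x z - t * ?W2)"
    if x: "x \<in> pverts D1" for x z
  proof -
    have "(\<Sum>e\<in>parcs D1. g (Inl (Inl x)) (Inl (Inr e)) * k (Inl (Inr e)) (Inl (Inl z))) =
        (\<Sum>e\<in>parcs D1. if e = (x, z) then 1 / t else 0)"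
      by (intro sum.cong) (auto simp: gVE k_def)
    also have "\<dots> = (if (x, z) \<in> parcs D1 then 1 / t else 0)"
      using D1.pair_finite_arcs by simp
    finally have "(\<Sum>q\<in>set (?E @ ?V2). g (Inl (Inl x)) q * k q (Inl (Inl z))) =
        (if (x, z) \<in> parcs D1 then 1 / t else 0) + ?W2"
      unfolding sumEV2 using x by (simp add: gV2 k_def)
    thus ?thesis
      using t by (simp add: gVV char_entry_def field_simps power2_eq_square)
  qed
  have "vertex_matrix (\<lambda>p z. g p z - (\<Sum>q\<in>set (?E @ ?V2). g p q * k q z)) ?V1 ?V1 =
      vertex_matrix (\<lambda>x z. 1 / t * (char_entry (t\<^sup>2) D1 x z - t * ?W2)) vs1 vs1"
    unfolding vertex_matrix_map using vs1' by (intro vertex_matrix_cong reduced) auto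
  also have "det \<dots> = (1 / t) ^ ?n *
      (det (vertex_matrix (char_entry (t\<^sup>2) D1) vs1 vs1) * (1 - t * ?W2 * ?W1))"
    unfolding det_vertex_matrix_scale
    using det_vertex_matrix_minus_const[OF vs1'(2), of "char_entry (t\<^sup>2) D1" w1 "t * ?W2"] w1 vs1'
      distinct_card[OF vs1'(2)] by simp
  finally have det2: "det (vertex_matrix (\<lambda>p z. g p z - (\<Sum>q\<in>set (?E @ ?V2). g p q * k q z)) ?V1 ?V1) =
      (1 / t) ^ ?n * (det (vertex_matrix (char_entry (t\<^sup>2) D1) vs1 vs1) * (1 - t * ?W2 * ?W1))" .
  have "det (vertex_matrix g vs vs) =
      det (vertex_matrix g ((?E @ ?V2) @ ?V1) ((?E @ ?V2) @ ?V1))"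
    using vs distE distV2 distV1 es vs1' vs2'
    by (intro det_vertex_matrix_reorder)
      (auto simp: vertex_ordering_def subdivision_vertex_join_def subdivision_digraph_def)
  also have "\<dots> = det (vertex_matrix g (?E @ ?V2) (?E @ ?V2)) *
      det (vertex_matrix (\<lambda>p z. g p z - (\<Sum>q\<in>set (?E @ ?V2). g p q * k q z)) ?V1 ?V1)"
    using distE distV2 by (intro det_vertex_matrix_eliminate solves) auto
  also have "\<dots> = (t ^ ?m * (1 / t) ^ ?n) * det (vertex_matrix (char_entry (t\<^sup>2) D1) vs1 vs1) *
           det (vertex_matrix (char_entry t D2) vs2 vs2) * (1 - t * ?W1 * ?W2)"
    unfolding det1 det2 by (simp add: mult_ac)
  also have "t ^ ?m * (1 / t) ^ ?n = t powi (int ?m - int ?n)"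
    using t by (simp add: power_int_diff power_one_over)
  finally show ?thesis unfolding g_def J_def .
qed

text \<open>
  The solutions required by the determinant formula come from the adjugate vectors, with \<open>\<lambda>\<^sup>2\<close>
  substituted for \<open>\<lambda>\<close> in the case of \<open>D1\<close>.
\<close>

lemma char_poly_join:
  fixes D1 :: "'a pair_pre_digraph" and D2 :: "'b pair_pre_digraph"
    and vs :: "(('a + 'a \<times> 'a) + 'b) list"
  assumes "simple_digraph D1" and "simple_digraph D2"
    and vs1: "vertex_ordering D1 vs1" and vs2: "vertex_ordering D2 vs2"
    and vs: "vertex_ordering (subdivision_vertex_join D1 D2) vs"
  shows "to_fract (char_poly (adjacency_matrix (subdivision_vertex_join D1 D2) vs)) =
           rat_var powi (int (card (parcs D1)) - int (card (pverts D1)))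
           * at_square (to_fract (char_poly (adjacency_matrix D1 vs1)))
           * to_fract (char_poly (adjacency_matrix D2 vs2))
           * (1 - rat_var * at_square (coronal (adjacency_matrix D1 vs1))
                          * coronal (adjacency_matrix D2 vs2))"
proof -
  define h :: "complex poly \<Rightarrow> ratfun" where "h = to_fract"
  define h2 :: "complex poly \<Rightarrow> ratfun" where "h2 q = to_fract (pcompose q (monom 1 2))" for q
  have h: "comm_ring_hom h" by unfold_locales (auto simp: h_def)
  have h2: "comm_ring_hom h2"
    by unfold_locales (auto simp: h2_def pcompose_add pcompose_mult)
  interpret h: comm_ring_hom h by fact
  interpret h2: comm_ring_hom h2 by fact
  have hX: "h [:0, 1:] = rat_var" and h2X: "h2 [:0, 1:] = rat_var\<^sup>2"
    by (simp_all add: h_def h2_def rat_var_def pcompose_pCons monom_altdef power2_eq_square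
        flip: to_fract_mult)
  have var: "rat_var \<noteq> 0" by (simp add: rat_var_def)
  have set1: "set vs1 = pverts D1" "distinct vs1" and set2: "set vs2 = pverts D2" "distinct vs2"
    and dvs: "distinct vs"
    using vs1 vs2 vs by (auto simp: vertex_ordering_def)
  let ?f1 = "char_poly (adjacency_matrix D1 vs1)" and ?f2 = "char_poly (adjacency_matrix D2 vs2)"
  have f1: "h2 ?f1 \<noteq> 0"
    using char_poly_adjacency_nonzero[of D1 vs1] pcompose_eq_0[of ?f1 "monom 1 2"]
    by (auto simp: h2_def degree_monom_eq)
  have f2: "h ?f2 \<noteq> 0"
    using char_poly_adjacency_nonzero[of D2 vs2] by (simp add: h_def)
  obtain p1 where p1:
    "\<And>x. x \<in> set vs1 \<Longrightarrow> (\<Sum>y\<in>set vs1. char_entry [:0, 1:] D1 x y * p1 y) = ?f1"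
    "to_fract ?f1 * coronal (adjacency_matrix D1 vs1) = to_fract (\<Sum>y\<in>set vs1. p1 y)"
    using char_poly_adjacency_solution[OF set1(2), of D1] by blast
  obtain p2 where p2:
    "\<And>x. x \<in> set vs2 \<Longrightarrow> (\<Sum>y\<in>set vs2. char_entry [:0, 1:] D2 x y * p2 y) = ?f2"
    "to_fract ?f2 * coronal (adjacency_matrix D2 vs2) = to_fract (\<Sum>y\<in>set vs2. p2 y)"
    using char_poly_adjacency_solution[OF set2(2), of D2] by blast
  have "coronal (adjacency_matrix D1 vs1) = to_fract (\<Sum>y\<in>set vs1. p1 y) / to_fract ?f1"
    using p1(2) char_poly_adjacency_nonzero[of D1 vs1] by (simp add: field_simps)
  hence cor1: "at_square (coronal (adjacency_matrix D1 vs1)) = (\<Sum>x\<in>pverts D1. h2 (p1 x) / h2 ?f1)"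
    using at_square_divide[OF char_poly_adjacency_nonzero[of D1 vs1], of "\<Sum>y\<in>set vs1. p1 y"]
    by (simp add: set1 h2.hom_sum sum_divide_distrib flip: h2_def)
  have cor2: "coronal (adjacency_matrix D2 vs2) = (\<Sum>x\<in>pverts D2. h (p2 x) / h ?f2)"
    using p2(2) f2 unfolding h_def[symmetric]
    by (simp add: set2 h.hom_sum field_simps flip: sum_divide_distrib)
  have sq1: "at_square (to_fract ?f1) = h2 ?f1"
    using at_square_divide[of 1 ?f1] by (simp add: h2_def)
  define w1 where "w1 x = h2 (p1 x) / h2 ?f1" for x
  define w2 where "w2 x = h (p2 x) / h ?f2" for x
  have w1: "(\<Sum>y\<in>pverts D1. char_entry (rat_var\<^sup>2) D1 x y * w1 y) = 1" if "x \<in> pverts D1" for x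
    using hom_coronal_solution[OF h2 p1(1) f1, of x] that by (simp add: w1_def h2X set1(1))
  have w2: "(\<Sum>y\<in>pverts D2. char_entry rat_var D2 x y * w2 y) = 1" if "x \<in> pverts D2" for x
    using hom_coronal_solution[OF h p2(1) f2, of x] that by (simp add: w2_def hX set2(1))
  have "h (char_poly (adjacency_matrix (subdivision_vertex_join D1 D2) vs)) =
      rat_var powi (int (card (parcs D1)) - int (card (pverts D1))) * h2 ?f1 * h ?f2
      * (1 - rat_var * (\<Sum>x\<in>pverts D1. w1 x) * (\<Sum>x\<in>pverts D2. w2 x))"
    unfolding hom_char_poly_adjacency[OF h dvs] hom_char_poly_adjacency[OF h set2(2)]
      hom_char_poly_adjacency[OF h2 set1(2)] hX h2X
    by (rule det_char_entry_join[OF assms(1,2) vs1 vs2 vs var w1 w2])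
  thus ?thesis
    unfolding cor1 cor2 sq1 by (simp add: h_def w1_def w2_def)
qed

theorem theorem4p3:
  fixes D1 :: "'a pair_pre_digraph" and D2 :: "'b pair_pre_digraph"
    and vs1 :: "'a list" and vs2 :: "'b list" and vs :: "(('a + 'a \<times> 'a) + 'b) list"
    and n1 n2 m1 m2 :: nat
  assumes "simple_digraph D1" and "simple_digraph D2"
    and "card (pverts D1) = n1" and "card (pverts D2) = n2"
    and "card (parcs D1) = m1" and "card (parcs D2) = m2"
    and "vertex_ordering D1 vs1" and "vertex_ordering D2 vs2"
    and "vertex_ordering (subdivision_vertex_join D1 D2) vs"
  shows "(to_fract (char_poly (adjacency_matrix (subdivision_vertex_join D1 D2) vs)) =
           rat_var powi (int m1 - int n1)
           * at_square (to_fract (char_poly (adjacency_matrix D1 vs1)))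
           * to_fract (char_poly (adjacency_matrix D2 vs2))
           * (1 - rat_var * at_square (coronal (adjacency_matrix D1 vs1))
                          * coronal (adjacency_matrix D2 vs2))) \<and>
         (\<forall>(E1 :: 'c pair_pre_digraph) (E2 :: 'd pair_pre_digraph) us1 us2 us.
           simple_digraph E1 \<longrightarrow> simple_digraph E2 \<longrightarrow>
           vertex_ordering E1 us1 \<longrightarrow> vertex_ordering E2 us2 \<longrightarrow>
           vertex_ordering (subdivision_vertex_join E1 E2) us \<longrightarrow>
           A_spectrum E1 us1 = A_spectrum D1 vs1 \<longrightarrow>
           A_spectrum E2 us2 = A_spectrum D2 vs2 \<longrightarrow>
           coronal (adjacency_matrix E1 us1) = coronal (adjacency_matrix D1 vs1) \<longrightarrow>
           coronal (adjacency_matrix E2 us2) = coronal (adjacency_matrix D2 vs2) \<longrightarrow>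
           A_spectrum (subdivision_vertex_join E1 E2) us
             = A_spectrum (subdivision_vertex_join D1 D2) vs)"
proof (intro conjI allI impI)
  note join = char_poly_join[OF assms(1,2,7,8,9)]
  show "to_fract (char_poly (adjacency_matrix (subdivision_vertex_join D1 D2) vs)) =
           rat_var powi (int m1 - int n1)
           * at_square (to_fract (char_poly (adjacency_matrix D1 vs1)))
           * to_fract (char_poly (adjacency_matrix D2 vs2))
           * (1 - rat_var * at_square (coronal (adjacency_matrix D1 vs1))
                          * coronal (adjacency_matrix D2 vs2))"
    using join unfolding assms(3,5) .
  fix E1 :: "'c pair_pre_digraph" and E2 :: "'d pair_pre_digraph" and us1 us2 us
  assume E: "simple_digraph E1" "simple_digraph E2" "vertex_ordering E1 us1"
    "vertex_ordering E2 us2" "vertex_ordering (subdivision_vertex_join E1 E2) us"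
    and spec: "A_spectrum E1 us1 = A_spectrum D1 vs1" "A_spectrum E2 us2 = A_spectrum D2 vs2"
    and cor: "coronal (adjacency_matrix E1 us1) = coronal (adjacency_matrix D1 vs1)"
      "coronal (adjacency_matrix E2 us2) = coronal (adjacency_matrix D2 vs2)"
  note f = char_poly_eq_of_spectrum_eq[OF spec(1)] char_poly_eq_of_spectrum_eq[OF spec(2)]
  note cards = card_eq_of_char_poly_coronal_eq[OF assms(1) E(1) assms(7) E(3) f(1) cor(1)]
  have "to_fract (char_poly (adjacency_matrix (subdivision_vertex_join E1 E2) us)) =
      to_fract (char_poly (adjacency_matrix (subdivision_vertex_join D1 D2) vs))"
    unfolding char_poly_join[OF E] join f cor cards ..
  thus "A_spectrum (subdivision_vertex_join E1 E2) us = A_spectrum (subdivision_vertex_join D1 D2) vs"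
    by (simp add: A_spectrum_def)
qed

end
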